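(* Let $n\ge 1$, let $A_0,A_1,\dots,A_n$ be signed sets, and let $f_{i-1,i}:A_{i-1}\Rrightarrow A_i$ be a cobordism for each $i=1,\dots,n$. Then the composite cobordism $f_{0,1}\triangleleft\cdots\triangleleft f_{n-1,n}:A_0\Rrightarrow A_n$ (for any choice of bracketing) satisfies $$|f_{0,1}\triangleleft\cdots\triangleleft f_{n-1,n}|=\operatorname{cancel}\bigl(|A_1|+\dots+|A_{n-1}|,\ |f_{0,1}|+\dots+|f_{n-1,n}|\bigr).$$ In particular, if $A_0,A_n\ge 0$ (i.e. $A_0$ and $A_n$ are unsigned sets), then $$\operatorname{cancel}\bigl(|A_1|+\dots+|A_{n-1}|,\ |f_{0,1}|+\dots+|f_{n-1,n}|\bigr): A_0\Rrightarrow A_n$$ is a matching (bijection) of the finite sets $A_0$ and $A_n$.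
   Context: A matching is a bijection between finite sets, written $P\Rrightarrow Q$. $X+Y$ denotes disjoint union, treated as strictly commutative and associative by the usual identifications; $X,Y$ are regarded as subsets of $X+Y$. For matchings $u:P\Rrightarrow Q$ and $v:R\Rrightarrow S$, $u+v:P+R\Rrightarrow Q+S$ is their disjoint union. Cancellation: if $F:P+E\Rrightarrow Q+E$ is a matching of finite sets (the two copies of $E$ being identified), then $\operatorname{cancel}(E,F):P\Rrightarrow Q$ is the matching sending $p$ to the first element outside the summand $E$ among $F(p),F(F(p)),\dots$. A signed set is an ordered pair $A=\langle A^+,A^-\rangle$ of finite sets; $|A|=A^+ + A^-$. $0$ denotes the empty set. An unsigned (finite) set $S$ is identified with the signed set $\langle S,0\rangle$; one writes $A\ge 0$ if $A$ is unsigned, i.e. $A^-=0$, in which case $A=A^+$. A cobordism $f:A\Rrightarrow B$ of signed sets is a triple $(|f|,A,B)$ where $|f|:A^+ + B^-\Rrightarrow A^- + B^+$ is a matching. Composition (in natural order, "$f$ then $g$"): for cobordisms $f:A\Rrightarrow B$ and $g:B\Rrightarrow C$, the disjoint union gives a matching $|f|+|g|: A^+ + |B| + C^-\Rrightarrow A^- + |B| + C^+$, and $f\triangleleft g:A\Rrightarrow C$ is the cobordism with $|f\triangleleft g|=\operatorname{cancel}(|B|,|f|+|g|): A^+ + C^-\Rrightarrow A^- + C^+$. Likewise $|f_{0,1}|+\dots+|f_{n-1,n}|$ is regarded as a matching $A_0^+ + |A_1|+\dots+|A_{n-1}| + A_n^-\Rrightarrow A_0^- + |A_1|+\dots+|A_{n-1}|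 + A_n^+$. (The sets at different positions in the chain are treated as separate summands even if they happen to be equal.) *)

theory Defs
  imports Main "HOL-Library.FuncSet"
begin

text \<open>
  A matching carries its domain and codomain, and its function is normalised to
  \<^const>\<open>undefined\<close> outside the domain, so that \<open>=\<close> is equality of matchings.
\<close>

record 'p matching =
  mdom :: "'p set"
  mcod :: "'p set"
  mapp :: "'p \<Rightarrow> 'p"

definition is_matching :: "'p matching \<Rightarrow> 'p set \<Rightarrow> 'p set \<Rightarrow> bool" where
  "is_matching F P Q \<longleftrightarrow>
     mdom F = P \<and> mcod F = Q \<and> finite P \<and> finite Q \<and>
     mapp F \<in> extensional P \<and> bij_betw (mapp F) P Q"

definition empty_matching :: "'p matching" where
  "empty_matching = \<lparr>mdom = {}, mcod = {}, mapp = (\<lambda>_. undefined)\<rparr>"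

text \<open>
  The union of matchings whose domains are disjoint and whose codomains are disjoint.
  Disjointness is always arranged beforehand by tagging the elements (see below).
\<close>

definition matching_plus :: "'p matching \<Rightarrow> 'p matching \<Rightarrow> 'p matching" (infixr "\<oplus>" 65) where
  "u \<oplus> v =
     \<lparr>mdom = mdom u \<union> mdom v,
      mcod = mcod u \<union> mcod v,
      mapp = restrict (\<lambda>p. if p \<in> mdom u then mapp u p else mapp v p) (mdom u \<union> mdom v)\<rparr>"

definition matching_sum :: "'p matching list \<Rightarrow> 'p matching" where
  "matching_sum us = foldr (\<oplus>) us empty_matching"

text \<open>
  Transport of a matching along an identification \<open>h\<close>, which is meant to be injective on the
  domain and on the codomain.
\<close>

definition relabel :: "('p \<Rightarrow> 'q) \<Rightarrow> 'p matching \<Rightarrow> 'q matching" where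
  "relabel h F =
     \<lparr>mdom = h ` mdom F,
      mcod = h ` mcod F,
      mapp = restrict (\<lambda>y. h (mapp F (inv_into (mdom F) h y))) (h ` mdom F)\<rparr>"

text \<open>
  For \<open>F : P + E \<Rrightarrow> Q + E\<close>, with \<open>E\<close> disjoint from \<open>P\<close> and \<open>Q\<close>, the domain and codomain
  below are \<open>P\<close> and \<open>Q\<close>.
\<close>

definition cancel :: "'p set \<Rightarrow> 'p matching \<Rightarrow> 'p matching" where
  "cancel E F =
     \<lparr>mdom = mdom F - E,
      mcod = mcod F - E,
      mapp = restrict (\<lambda>p. (mapp F ^^ (LEAST k. 0 < k \<and> (mapp F ^^ k) p \<notin> E)) p) (mdom F - E)\<rparr>"

type_synonym 'a signed = "'a set \<times> 'a set"

abbreviation pos :: "'a signed \<Rightarrow> 'a set" where "pos \<equiv> fst"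
abbreviation neg :: "'a signed \<Rightarrow> 'a set" where "neg \<equiv> snd"

definition signed_set :: "'a signed \<Rightarrow> bool" where
  "signed_set A \<longleftrightarrow> finite (pos A) \<and> finite (neg A)"

definition unsigned :: "'a signed \<Rightarrow> bool" where
  "unsigned A \<longleftrightarrow> neg A = {}"

text \<open>
  Disjoint unions are realised by tags: \<open>(i, s, a)\<close> is the copy of \<open>a\<close> in the part of sign \<open>s\<close>
  of the signed set at position \<open>i\<close> of a chain.
\<close>

datatype sign = Plus | Minus

type_synonym 'a point = "nat \<times> sign \<times> 'a"

definition summand :: "nat \<Rightarrow> sign \<Rightarrow> 'a set \<Rightarrow> 'a point set" where
  "summand i s X = {i} \<times> {s} \<times> X"

definition abs_at :: "nat \<Rightarrow> 'a signed \<Rightarrow> 'a point set" where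
  "abs_at i A = summand i Plus (pos A) \<union> summand i Minus (neg A)"

text \<open>
  In a cobordism from \<open>A\<close> to \<open>B\<close>, the signed set \<open>A\<close> sits at position \<open>0\<close> and \<open>B\<close> at
  position \<open>1\<close>.
\<close>

record 'a cobordism =
  under :: "'a point matching"
  source :: "'a signed"
  target :: "'a signed"

definition is_cobordism :: "'a cobordism \<Rightarrow> 'a signed \<Rightarrow> 'a signed \<Rightarrow> bool" where
  "is_cobordism f A B \<longleftrightarrow>
     source f = A \<and> target f = B \<and> signed_set A \<and> signed_set B \<and>
     is_matching (under f)
       (summand 0 Plus (pos A) \<union> summand 1 Minus (neg B))
       (summand 0 Minus (neg A) \<union> summand 1 Plus (pos B))"

text \<open>
  \<open>place i j\<close> moves the two ends of a cobordism from positions \<open>0\<close>, \<open>1\<close> to positions \<open>i\<close>, \<open>j\<close>.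
\<close>

definition place :: "nat \<Rightarrow> nat \<Rightarrow> 'a point matching \<Rightarrow> 'a point matching" where
  "place i j F = relabel (apfst (\<lambda>k. if k = 0 then i else j)) F"

text \<open>
  In a composite, the three signed sets are at positions \<open>0\<close>, \<open>1\<close>, \<open>2\<close>; after the middle one has
  been cancelled, position \<open>2\<close> becomes position \<open>1\<close>.
\<close>

definition compose :: "'a cobordism \<Rightarrow> 'a cobordism \<Rightarrow> 'a cobordism" (infixl "\<triangleleft>" 70) where
  "f \<triangleleft> g =
     \<lparr>under = relabel (apfst (\<lambda>k. if k = 0 then 0 else 1))
        (cancel (abs_at 1 (target f)) (place 0 1 (under f) \<oplus> place 1 2 (under g))),
      source = source f,
      target = target g\<rparr>"

datatype 'c bracketing = Leaf 'c | Node "'c bracketing" "'c bracketing"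

fun leaves :: "'c bracketing \<Rightarrow> 'c list" where
  "leaves (Leaf c) = [c]"
| "leaves (Node l r) = leaves l @ leaves r"

fun composite :: "'a cobordism bracketing \<Rightarrow> 'a cobordism" where
  "composite (Leaf f) = f"
| "composite (Node l r) = composite l \<triangleleft> composite r"

text \<open>
  \<open>f i\<close> stands for $f_{i-1,i}$, and \<open>chain_sum n f\<close> for $|f_{0,1}| + \dots + |f_{n-1,n}|$.
\<close>

definition chain_sum :: "nat \<Rightarrow> (nat \<Rightarrow> 'a cobordism) \<Rightarrow> 'a point matching" where
  "chain_sum n f = matching_sum (map (\<lambda>i. place (i - 1) i (under (f i))) [1..<n + 1])"

definition untag :: "'a point \<Rightarrow> 'a" where
  "untag p = snd (snd p)"

end

theory Submission
  imports Defs
begin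

text \<open>
  Cancellation follows the orbit of a point until it leaves the cancelled summand. Hence cancelling
  two disjoint summands one after the other is the same as cancelling their union, and cancelling
  inside one term of a sum of matchings is the same as cancelling inside the whole sum. So every
  bracketing of a composite cancels, in some order, exactly the interior signed sets of the chain
  from the sum of all the matchings.
\<close>

section \<open>First exits\<close>

text \<open>\<open>cancel\<close> is given by a least exponent, and least exponents of composite
  orbits are awkward to compare. The inductive relation \<open>exits\<close> records the same orbit
  step by step, so gluing and transporting orbits become rule inductions. An exit need not exist: a
  matching can contain a cycle lying inside \<open>E\<close>. For a start outside \<open>E\<close>,
  finiteness and injectivity exclude this, so identities are checked at such starts only. The second
  obstacle is bookkeeping. \<open>compose\<close> renumbers its ends to \<open>0\<close> and
  \<open>1\<close>, so two bracketings do not speak about the same tagged points. They become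
  comparable once \<open>place\<close> puts each composite at the positions that its ends have in
  the chain; the induction over bracketings therefore concerns an arbitrary segment from
  \<open>a\<close> to \<open>b\<close>.\<close>

inductive exits :: "'p set \<Rightarrow> ('p \<Rightarrow> 'p) \<Rightarrow> 'p \<Rightarrow> 'p \<Rightarrow> bool" for E g where
  exits_base: "g p \<notin> E \<Longrightarrow> exits E g p (g p)"
| exits_step: "g p \<in> E \<Longrightarrow> exits E g (g p) q \<Longrightarrow> exits E g p q"

section \<open>First exits as iterates, their existence and their injectivity\<close>

lemma exits_funpow:
  assumes "exits E g p q"
  shows "\<exists>k>0. (g ^^ k) p = q \<and> q \<notin> E \<and> (\<forall>j. 0 < j \<and> j < k \<longrightarrow> (g ^^ j) p \<in> E)"
  using assms
proof induction
  case (exits_base p)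
  then show ?case by (intro exI[of _ 1]) auto
next
  case (exits_step p q)
  then obtain k where k: "k > 0" "(g ^^ k) (g p) = q" "q \<notin> E"
    "\<And>j. 0 < j \<Longrightarrow> j < k \<Longrightarrow> (g ^^ j) (g p) \<in> E"
    by blast
  have "(g ^^ j) p \<in> E" if "0 < j" "j < Suc k" for j
  proof (cases j)
    case (Suc i)
    then show ?thesis
      using that k(4)[of i] exits_step.hyps(1) by (cases "i = 0") (auto simp: funpow_swap1)
  qed (use that in simp)
  then show ?case
    using k(2,3) by (intro exI[of _ "Suc k"]) (auto simp: funpow_swap1)
qed

text \<open>Trades the least exponent in \<open>cancel\<close> for a derivation of
  \<open>exits\<close>; equations between cancellations are proved through it.\<close>

lemma exits_Least:
  assumes "exits E g p q"
  shows "(g ^^ (LEAST k. 0 < k \<and> (g ^^ k) p \<notin> E)) p = q"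
proof -
  obtain k where k: "k > 0" "(g ^^ k) p = q" "q \<notin> E" "\<forall>j. 0 < j \<and> j < k \<longrightarrow> (g ^^ j) p \<in> E"
    using exits_funpow[OF assms] by blast
  then have "(LEAST k. 0 < k \<and> (g ^^ k) p \<notin> E) = k"
    by (intro Least_equality) (auto simp: not_less[symmetric])
  with k show ?thesis by simp
qed

text \<open>An injective map can be undone along two orbits as long as both stay where it is
  injective. The last \<open>k\<close> steps are removed one by one, and \<open>d\<close> is the
  difference of the two running times.\<close>

lemma funpow_cancel_left:
  assumes inj: "inj_on g D"
    and "\<And>j. j < k \<Longrightarrow> (g ^^ j) p \<in> D"
    and "\<And>j. j < k + d \<Longrightarrow> (g ^^ j) p' \<in> D"
    and "(g ^^ k) p = (g ^^ (k + d)) p'"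
  shows "p = (g ^^ d) p'"
  using assms(2-)
proof (induction k)
  case (Suc k)
  have "(g ^^ k) p = (g ^^ (k + d)) p'"
    using inj_onD[OF inj, of "(g ^^ k) p" "(g ^^ (k + d)) p'"] Suc.prems by simp
  then show ?case using Suc by simp
qed simp

text \<open>An orbit that never left \<open>E\<close> would repeat by finiteness. Injectivity pulls
  a repetition back to a return to \<open>p\<close>, whereas all later points lie in
  \<open>E\<close> and \<open>p\<close> does not.\<close>

lemma exits_exists:
  assumes "finite E" "inj_on g (insert p E)" "p \<notin> E"
  shows "\<exists>q. exits E g p q"
proof (rule ccontr)
  assume none: "\<nexists>q. exits E g p q"
  \<comment> \<open>The second conjunct carries the induction: a point without an exit has its image
    in \<open>E\<close>, and that image has no exit either.\<close>
  have stay: "(g ^^ Suc k) p \<in> E \<and> (\<nexists>q. exits E g ((g ^^ Suc k) p) q)" for k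
  proof (induction k)
    case 0
    then show ?case using none exits_base[of g p E] exits_step[of g p E] by auto
  next
    case (Suc k)
    then show ?case
      using exits_base[of g "(g ^^ Suc k) p" E] exits_step[of g "(g ^^ Suc k) p" E] by auto
  qed
  then have orbit: "(g ^^ k) p \<in> insert p E" for k
    by (cases k) auto
  have "inj (\<lambda>k. (g ^^ k) p)"
  proof (rule linorder_injI)
    fix i j :: nat
    assume "i < j"
    show "(g ^^ i) p \<noteq> (g ^^ j) p"
    proof
      assume eq: "(g ^^ i) p = (g ^^ j) p"
      have "p = (g ^^ (j - i)) p"
        by (rule funpow_cancel_left[OF assms(2), where k = i]) (use orbit \<open>i < j\<close> eq in auto)
      moreover obtain k where "j - i = Suc k"
        using \<open>i < j\<close> by (metis Suc_diff_Suc)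
      ultimately show False
        using stay[of k] assms(3) by metis
    qed
  qed
  moreover have "finite (range (\<lambda>k. (g ^^ k) p))"
    by (rule finite_subset[of _ "insert p E"]) (use orbit assms(1) in auto)
  ultimately show False
    using finite_imageD infinite_UNIV_nat by blast
qed

lemma exits_target:
  assumes "exits E g p q" "g ` insert p E \<subseteq> C"
  shows "q \<in> C - E"
  using assms by induction auto

text \<open>Both orbits end at \<open>q\<close>; run them back together. If the exit times differed,
  the start of the shorter orbit would be an inner point of the longer one and hence lie in
  \<open>E\<close>.\<close>

lemma exits_inj:
  assumes "exits E g p q" "exits E g p' q"
    and inj: "inj_on g D" and D: "E \<subseteq> D" "p \<in> D - E" "p' \<in> D - E"
  shows "p = p'"
proof -
  \<comment> \<open>Stated for \<open>k \<le> l\<close> and arbitrary starts, so that it serves both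
    orders of the exit times.\<close>
  have aux: "p = p'"
    if k: "\<forall>j. 0 < j \<and> j < k \<longrightarrow> (g ^^ j) p \<in> E"
      and l: "\<forall>j. 0 < j \<and> j < l \<longrightarrow> (g ^^ j) p' \<in> E"
      and eq: "(g ^^ k) p = (g ^^ l) p'"
      and "0 < k" "k \<le> l" and pp: "p \<in> D - E" "p' \<in> D - E"
    for p p' k l
  proof -
    have "(g ^^ j) p \<in> D" if "j < k" for j
      using that k pp D(1) by (cases "j = 0") auto
    moreover have "(g ^^ j) p' \<in> D" if "j < l" for j
      using that l pp D(1) by (cases "j = 0") auto
    ultimately have p: "p = (g ^^ (l - k)) p'"
      by - (rule funpow_cancel_left[OF inj, where k = k], use eq \<open>k \<le> l\<close> in auto)
    show ?thesis
    proof (cases "k = l")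
      case False
      then have "(g ^^ (l - k)) p' \<in> E"
        using l \<open>0 < k\<close> \<open>k \<le> l\<close> by simp
      then show ?thesis using p pp by simp
    qed (use p in simp)
  qed
  obtain k where k: "k > 0" "(g ^^ k) p = q" "\<forall>j. 0 < j \<and> j < k \<longrightarrow> (g ^^ j) p \<in> E"
    using exits_funpow[OF assms(1)] by blast
  obtain l where l: "l > 0" "(g ^^ l) p' = q" "\<forall>j. 0 < j \<and> j < l \<longrightarrow> (g ^^ j) p' \<in> E"
    using exits_funpow[OF assms(2)] by blast
  show ?thesis
    using aux[of k p l p'] aux[of l p' k p] k l D by (cases "k \<le> l") auto
qed

text \<open>The orbit is carried over point by point. The last hypothesis stands in for injectivity
  of \<open>h\<close>: the exit point must not be mapped back into the image of
  \<open>E\<close>.\<close>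

lemma exits_map:
  assumes "exits E g p q"
    and "\<And>x. x \<in> insert p E \<Longrightarrow> g' (h x) = h (g x)"
    and "\<And>x. x \<in> insert p E \<Longrightarrow> h (g x) \<in> h ` E \<Longrightarrow> g x \<in> E"
  shows "exits (h ` E) g' (h p) (h q)"
  using assms
proof induction
  case (exits_base p)
  then show ?case using exits.exits_base[of g' "h p" "h ` E"] by auto
next
  case (exits_step p q)
  then have "exits (h ` E) g' (g' (h p)) (h q)" by auto
  moreover have "g' (h p) \<in> h ` E"
    using exits_step by auto
  ultimately show ?case by (rule exits.exits_step[rotated])
qed

lemma exits_cong:
  assumes "exits E g p q" "\<And>x. x \<in> insert p E \<Longrightarrow> g' x = g x"
  shows "exits E g' p q"
  using exits_map[OF assms(1), of g' id] assms(2) by simp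

text \<open>A first exit from \<open>E\<close> is either final for the larger set or a station in
  \<open>E'\<close> from which the orbit goes on; this lemma treats the former,
  \<open>exits_Un_trans\<close> the latter.\<close>

lemma exits_Un_final:
  "exits E g p q \<Longrightarrow> q \<notin> E' \<Longrightarrow> exits (E \<union> E') g p q"
  by (induction rule: exits.induct) (auto intro: exits.intros)

lemma exits_Un_trans:
  "exits E g p r \<Longrightarrow> r \<in> E' \<Longrightarrow> exits (E \<union> E') g r q \<Longrightarrow> exits (E \<union> E') g p q"
  by (induction rule: exits.induct) (auto intro: exits.intros)


section \<open>Matchings\<close>

lemma matching_eqI:
  fixes F G :: "'p matching"
  assumes "mdom F = mdom G" "mcod F = mcod G"
    and "mapp F \<in> extensional (mdom F)" "mapp G \<in> extensional (mdom G)"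
    and "\<And>p. p \<in> mdom F \<Longrightarrow> mapp F p = mapp G p"
  shows "F = G"
proof (rule matching.equality)
  show "mapp F = mapp G"
    by (rule extensionalityI[of _ "mdom F"]) (use assms in auto)
qed (use assms in auto)

lemma is_matchingD:
  assumes "is_matching F P Q"
  shows "mdom F = P" "mcod F = Q" "finite P" "finite Q" "mapp F \<in> extensional (mdom F)"
    "inj_on (mapp F) P" "mapp F ` P = Q"
  using assms by (auto simp: is_matching_def bij_betw_def)

text \<open>The form in which identities for \<open>cancel\<close> are proved: a candidate
  \<open>G\<close> is verified by one exit derivation per outer point.\<close>

lemma cancel_eqI:
  assumes "mdom G = mdom F - E" "mcod G = mcod F - E" "mapp G \<in> extensional (mdom G)"
    and "\<And>p. p \<in> mdom F - E \<Longrightarrow> exits E (mapp F) p (mapp G p)"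
  shows "cancel E F = G"
  by (rule matching_eqI) (use assms in \<open>auto simp: cancel_def exits_Least\<close>)

lemma exits_cancel:
  assumes F: "is_matching F (P \<union> E) (Q \<union> E)" and p: "p \<in> P - E"
  shows "exits E (mapp F) p (mapp (cancel E F) p)"
proof -
  have "finite E"
    using is_matchingD(3)[OF F] by simp
  moreover have "inj_on (mapp F) (insert p E)"
    by (rule inj_on_subset[OF is_matchingD(6)[OF F]]) (use p in auto)
  ultimately obtain q where "exits E (mapp F) p q"
    using exits_exists[of E "mapp F" p] p by auto
  moreover have "p \<in> mdom F - E"
    using is_matchingD(1)[OF F] p by auto
  ultimately show ?thesis
    by (simp add: cancel_def exits_Least)
qed

lemma is_matching_cancel:
  assumes F: "is_matching F (P \<union> E) (Q \<union> E)" and disj: "P \<inter> E = {}" "Q \<inter> E = {}"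
  shows "is_matching (cancel E F) P Q"
proof -
  note D = is_matchingD[OF F]
  let ?g = "mapp (cancel E F)"
  have ex: "exits E (mapp F) p (?g p)" if "p \<in> P" for p
    using exits_cancel[OF F] that disj by blast
  have inj: "inj_on ?g P"
  proof (rule inj_onI)
    fix p p'
    assume "p \<in> P" "p' \<in> P" "?g p = ?g p'"
    then show "p = p'"
      using exits_inj[OF ex[of p] _ D(6)] ex[of p'] disj by auto
  qed
  have sub: "?g ` P \<subseteq> Q"
    using exits_target[OF ex, of _ "Q \<union> E"] D(7) by fastforce
  \<comment> \<open>Surjectivity by counting instead of a backward search for preimages: the finite
    set \<open>E\<close> contributes equally to both sides, so an injection of \<open>P\<close> into
    \<open>Q\<close> is onto.\<close>
  have "card (P \<union> E) = card (Q \<union> E)"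
    using card_image[OF D(6)] D(7) by simp
  then have "card P = card Q"
    using D(3,4) disj by (simp add: card_Un_disjoint)
  then have "?g ` P = Q"
    using sub inj D(4) by (intro card_subset_eq) (auto simp: card_image)
  moreover have "mdom F - E = P" "mcod F - E = Q"
    using D(1,2) disj by auto
  ultimately show ?thesis
    using inj D(3,4) by (simp add: is_matching_def bij_betw_def cancel_def)
qed

lemma cancel_cancel:
  assumes F: "is_matching F (P \<union> E \<union> E') (Q \<union> E \<union> E')"
    and disj: "P \<inter> (E \<union> E') = {}" "Q \<inter> (E \<union> E') = {}" "E \<inter> E' = {}"
  shows "cancel E' (cancel E F) = cancel (E \<union> E') F"
proof -
  note D = is_matchingD[OF F]
  \<comment> \<open>While \<open>E\<close> is cancelled, \<open>E'\<close> counts among the outer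
    points on both sides.\<close>
  have F1: "is_matching F ((P \<union> E') \<union> E) ((Q \<union> E') \<union> E)"
    using F by (simp add: Un_ac)
  have G: "is_matching (cancel E F) (P \<union> E') (Q \<union> E')"
    by (rule is_matching_cancel[OF F1]) (use disj in auto)
  have GG: "is_matching (cancel E' (cancel E F)) P Q"
    by (rule is_matching_cancel[OF G]) (use disj in auto)
  \<comment> \<open>Each step of \<open>cancel E F\<close> is a whole excursion of \<open>F\<close>
    through \<open>E\<close>. Starts in \<open>E'\<close> are included because the outer orbit
    passes through them; they lie outside \<open>E\<close>, so their excursions end.\<close>
  have nested: "exits (E \<union> E') (mapp F) p q"
    if "exits E' (mapp (cancel E F)) p q" "p \<in> P \<union> E'" for p q
    using that
  proof induction
    case (exits_base p)
    then show ?case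
      using exits_Un_final[OF exits_cancel[OF F1, of p]] disj by blast
  next
    case (exits_step p q)
    then show ?case
      using exits_Un_trans[OF exits_cancel[OF F1, of p]] disj by blast
  qed
  show ?thesis
  proof (rule cancel_eqI[symmetric])
    fix p
    assume "p \<in> mdom F - (E \<union> E')"
    then have p: "p \<in> P" using D(1) by auto
    then show "exits (E \<union> E') (mapp F) p (mapp (cancel E' (cancel E F)) p)"
      using exits_cancel[OF G, of p] disj nested by blast
  next
    show "mapp (cancel E' (cancel E F)) \<in> extensional (mdom (cancel E' (cancel E F)))"
      by (rule is_matchingD(5)[OF GG])
  qed (auto simp: cancel_def)
qed


section \<open>Sums of matchings\<close>

text \<open>In either bracketing the leftmost summand whose domain contains a point decides its
  image. Commutativity, in contrast, rests on disjoint domains.\<close>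

lemma matching_plus_assoc: "(u \<oplus> v) \<oplus> w = u \<oplus> (v \<oplus> w)"
  by (rule matching_eqI) (auto simp: matching_plus_def)

lemma matching_plus_commute:
  "mdom u \<inter> mdom v = {} \<Longrightarrow> u \<oplus> v = v \<oplus> u"
  by (rule matching_eqI) (auto simp: matching_plus_def)

lemma empty_matching_plus:
  "mapp u \<in> extensional (mdom u) \<Longrightarrow> empty_matching \<oplus> u = u"
  by (rule matching_eqI) (auto simp: matching_plus_def empty_matching_def)

lemma matching_plus_empty:
  "mapp u \<in> extensional (mdom u) \<Longrightarrow> u \<oplus> empty_matching = u"
  by (rule matching_eqI) (auto simp: matching_plus_def empty_matching_def)

lemma extensional_matching_sum: "mapp (matching_sum us) \<in> extensional (mdom (matching_sum us))"
  by (cases us) (auto simp: matching_sum_def matching_plus_def empty_matching_def)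

lemma matching_sum_append: "matching_sum (us @ vs) = matching_sum us \<oplus> matching_sum vs"
proof (induction us)
  case Nil
  then show ?case
    using empty_matching_plus[OF extensional_matching_sum[of vs]] by (simp add: matching_sum_def)
next
  case (Cons u us)
  then show ?case by (simp add: matching_sum_def matching_plus_assoc)
qed

lemma matching_sum_single:
  "mapp u \<in> extensional (mdom u) \<Longrightarrow> matching_sum [u] = u"
  by (simp add: matching_sum_def matching_plus_empty)

lemma is_matching_plus:
  assumes u: "is_matching u P Q" and v: "is_matching v R S" and disj: "P \<inter> R = {}" "Q \<inter> S = {}"
  shows "is_matching (u \<oplus> v) (P \<union> R) (Q \<union> S)"
proof -
  note U = is_matchingD[OF u] and V = is_matchingD[OF v]
  have "bij_betw (mapp (u \<oplus> v)) P Q"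
    using u U(1) by (auto simp: is_matching_def matching_plus_def cong: bij_betw_cong)
  moreover have "bij_betw (mapp (u \<oplus> v)) R S \<longleftrightarrow> bij_betw (mapp v) R S"
    by (rule bij_betw_cong) (use U(1) V(1) disj in \<open>auto simp: matching_plus_def\<close>)
  ultimately have "bij_betw (mapp (u \<oplus> v)) (P \<union> R) (Q \<union> S)"
    using v disj by (intro bij_betw_combine) (auto simp: is_matching_def)
  then show ?thesis
    using U V by (auto simp: is_matching_def matching_plus_def)
qed

text \<open>All of \<open>E\<close> belongs to the domain of \<open>u\<close>, so an orbit inside
  \<open>E\<close> never consults \<open>v\<close>. A start in \<open>R\<close> is sent by
  \<open>v\<close> into \<open>S\<close>, outside \<open>E\<close>, and exits at once.\<close>

lemma cancel_plus_left:
  assumes u: "is_matching u (P \<union> E) (Q \<union> E)" and v: "is_matching v R S"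
    and disj: "(P \<union> E) \<inter> R = {}" "E \<inter> S = {}"
  shows "cancel E (u \<oplus> v) = cancel E u \<oplus> v"
proof (rule cancel_eqI)
  note U = is_matchingD[OF u] and V = is_matchingD[OF v]
  show "mdom (cancel E u \<oplus> v) = mdom (u \<oplus> v) - E"
    "mcod (cancel E u \<oplus> v) = mcod (u \<oplus> v) - E"
    using U V disj by (auto simp: matching_plus_def cancel_def)
  show "mapp (cancel E u \<oplus> v) \<in> extensional (mdom (cancel E u \<oplus> v))"
    by (simp add: matching_plus_def)
  fix p
  assume p: "p \<in> mdom (u \<oplus> v) - E"
  show "exits E (mapp (u \<oplus> v)) p (mapp (cancel E u \<oplus> v) p)"
  proof (cases "p \<in> P")
    case True
    then have "exits E (mapp u) p (mapp (cancel E u) p)"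
      using exits_cancel[OF u] p by blast
    moreover have "mapp (cancel E u \<oplus> v) p = mapp (cancel E u) p"
      using True p U(1) by (auto simp: matching_plus_def cancel_def)
    ultimately show ?thesis
      by (auto intro: exits_cong simp: matching_plus_def U(1) True)
  next
    case False
    then have "p \<in> R" "mapp (u \<oplus> v) p = mapp v p" "mapp (cancel E u \<oplus> v) p = mapp v p"
      using p U(1) V(1) by (auto simp: matching_plus_def cancel_def)
    moreover have "mapp v p \<notin> E"
      using \<open>p \<in> R\<close> V(7) disj by blast
    ultimately show ?thesis
      using exits_base[of "mapp (u \<oplus> v)" p E] by simp
  qed
qed

lemma cancel_plus_right:
  assumes u: "is_matching u P Q" and v: "is_matching v (R \<union> E) (S \<union> E)"
    and disj: "P \<inter> (R \<union> E) = {}" "Q \<inter> E = {}"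
  shows "cancel E (u \<oplus> v) = u \<oplus> cancel E v"
proof -
  have "cancel E (u \<oplus> v) = cancel E (v \<oplus> u)"
    using is_matchingD(1)[OF u] is_matchingD(1)[OF v] disj by (subst matching_plus_commute) auto
  also have "\<dots> = cancel E v \<oplus> u"
    by (rule cancel_plus_left[OF v u]) (use disj in auto)
  also have "\<dots> = u \<oplus> cancel E v"
    using is_matchingD(1)[OF u] is_matchingD(1)[OF v] disj
    by (intro matching_plus_commute) (auto simp: cancel_def)
  finally show ?thesis .
qed


section \<open>Relabelling\<close>

lemma mapp_relabel:
  "inj_on h (mdom F) \<Longrightarrow> p \<in> mdom F \<Longrightarrow> mapp (relabel h F) (h p) = h (mapp F p)"
  by (simp add: relabel_def)

lemma relabel_simps [simp]:
  "mdom (relabel h F) = h ` mdom F"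
  "mcod (relabel h F) = h ` mcod F"
  "mapp (relabel h F) \<in> extensional (h ` mdom F)"
  by (simp_all add: relabel_def)

text \<open>Injectivity is asked on \<open>P\<close> and \<open>Q\<close> separately, since the
  final untagging may identify a point of the first signed set with a point of the last.\<close>

lemma is_matching_relabel:
  assumes F: "is_matching F P Q" and inj: "inj_on h P" "inj_on h Q"
  shows "is_matching (relabel h F) (h ` P) (h ` Q)"
proof -
  note D = is_matchingD[OF F]
  have eq: "mapp (relabel h F) (h p) = h (mapp F p)" if "p \<in> P" for p
    using mapp_relabel[of h F p] D(1) inj that by simp
  have "inj_on (mapp (relabel h F)) (h ` P)"
  proof (rule inj_onI, clarify)
    fix p p'
    assume "p \<in> P" "p' \<in> P" "mapp (relabel h F) (h p) = mapp (relabel h F) (h p')"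
    then have "mapp F p = mapp F p'"
      using eq D(7) inj_onD[OF inj(2)] by auto
    then show "h p = h p'"
      using inj_onD[OF D(6)] \<open>p \<in> P\<close> \<open>p' \<in> P\<close> by metis
  qed
  moreover have "mapp (relabel h F) ` h ` P = h ` Q"
    using eq D(7) by (force simp: image_image)
  ultimately show ?thesis
    using D relabel_simps(3)[of h F] by (simp add: is_matching_def bij_betw_def)
qed

lemma relabel_relabel:
  assumes "inj_on h (mdom F)" "inj_on g (h ` mdom F)"
  shows "relabel g (relabel h F) = relabel (g \<circ> h) F"
proof (rule matching_eqI)
  fix p
  assume "p \<in> mdom (relabel g (relabel h F))"
  then obtain x where x: "x \<in> mdom F" "p = g (h x)" by auto
  then show "mapp (relabel g (relabel h F)) p = mapp (relabel (g \<circ> h) F) p"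
    using assms mapp_relabel[of g "relabel h F" "h x"] mapp_relabel[of h F x]
      mapp_relabel[of "g \<circ> h" F x] by (simp add: comp_inj_on)
next
  show "mapp (relabel g (relabel h F)) \<in> extensional (mdom (relabel g (relabel h F)))"
    using relabel_simps(3)[of g "relabel h F"] by simp
  show "mapp (relabel (g \<circ> h) F) \<in> extensional (mdom (relabel (g \<circ> h) F))"
    using relabel_simps(3)[of "g \<circ> h" F] by simp
qed (auto simp: image_image)

text \<open>Lets two renumberings be exchanged that differ only at a position already
  cancelled.\<close>

lemma relabel_cong:
  assumes F: "is_matching F P Q" and "inj_on h P" and eq: "\<And>x. x \<in> P \<union> Q \<Longrightarrow> h x = h' x"
  shows "relabel h F = relabel h' F"
proof (rule matching_eqI)
  note D = is_matchingD[OF F]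
  show "mdom (relabel h F) = mdom (relabel h' F)" "mcod (relabel h F) = mcod (relabel h' F)"
    using D eq by (auto simp: image_def)
  have inj': "inj_on h' P"
    using \<open>inj_on h P\<close> eq inj_on_cong[of P h h'] by simp
  fix p
  assume "p \<in> mdom (relabel h F)"
  then obtain x where x: "x \<in> P" "p = h x" using D by auto
  moreover have "mapp F x \<in> Q" using x D(7) by auto
  ultimately show "mapp (relabel h F) p = mapp (relabel h' F) p"
    using mapp_relabel[of h F x] mapp_relabel[of h' F x] D(1) eq inj' \<open>inj_on h P\<close> by simp
qed simp_all

lemma relabel_plus:
  assumes "inj_on h (mdom u \<union> mdom v)"
  shows "relabel h (u \<oplus> v) = relabel h u \<oplus> relabel h v"
proof (rule matching_eqI)
  show "mdom (relabel h (u \<oplus> v)) = mdom (relabel h u \<oplus> relabel h v)"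
    "mcod (relabel h (u \<oplus> v)) = mcod (relabel h u \<oplus> relabel h v)"
    by (auto simp: matching_plus_def)
  have inj: "inj_on h (mdom u)" "inj_on h (mdom v)" "inj_on h (mdom (u \<oplus> v))"
    using assms by (auto simp: matching_plus_def intro: inj_on_subset)
  fix p
  assume "p \<in> mdom (relabel h (u \<oplus> v))"
  then obtain x where x: "x \<in> mdom u \<union> mdom v" "p = h x"
    by (auto simp: matching_plus_def)
  \<comment> \<open>This is where injectivity on the union enters: a point of \<open>v\<close> must
    not land on the relabelled domain of \<open>u\<close>.\<close>
  have mem: "h x \<in> h ` mdom u \<longleftrightarrow> x \<in> mdom u"
    using assms x(1) by (auto dest: inj_onD)
  have "mapp (relabel h (u \<oplus> v)) p = h (mapp (u \<oplus> v) x)"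
    using mapp_relabel[OF inj(3), of x] x by (simp add: matching_plus_def)
  also have "\<dots> = mapp (relabel h u \<oplus> relabel h v) p"
    using x mem mapp_relabel[OF inj(1), of x] mapp_relabel[OF inj(2), of x]
    by (auto simp: matching_plus_def)
  finally show "mapp (relabel h (u \<oplus> v)) p = mapp (relabel h u \<oplus> relabel h v) p" .
next
  show "mapp (relabel h u \<oplus> relabel h v) \<in> extensional (mdom (relabel h u \<oplus> relabel h v))"
    by (simp add: matching_plus_def)
qed simp

lemma relabel_cancel:
  assumes F: "is_matching F (P \<union> E) (Q \<union> E)" and inj: "inj_on h (P \<union> E)" "inj_on h (Q \<union> E)"
  shows "relabel h (cancel E F) = cancel (h ` E) (relabel h F)"
proof (rule cancel_eqI[symmetric])
  note D = is_matchingD[OF F]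
  show "mdom (relabel h (cancel E F)) = mdom (relabel h F) - h ` E"
    "mcod (relabel h (cancel E F)) = mcod (relabel h F) - h ` E"
    using D inj by (auto simp: cancel_def dest: inj_onD)
  fix p
  assume "p \<in> mdom (relabel h F) - h ` E"
  then obtain x where x: "x \<in> P - E" "p = h x" using D(1) by auto
  have "exits (h ` E) (mapp (relabel h F)) (h x) (h (mapp (cancel E F) x))"
  proof (rule exits_map[OF exits_cancel[OF F x(1)]])
    fix y
    assume "y \<in> insert x E"
    then have y: "y \<in> P \<union> E" using x by auto
    then show "mapp (relabel h F) (h y) = h (mapp F y)"
      using mapp_relabel[of h F y] D(1) inj by simp
    \<comment> \<open>The image of \<open>y\<close> and the set \<open>E\<close> both lie in
      \<open>Q \<union> E\<close>, so injectivity there decides membership.\<close>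
    assume "h (mapp F y) \<in> h ` E"
    moreover have "mapp F y \<in> Q \<union> E" using y D(7) by blast
    ultimately show "mapp F y \<in> E"
      using inj(2) by (auto dest: inj_onD)
  qed
  moreover have "mapp (relabel h (cancel E F)) p = h (mapp (cancel E F) x)"
    using x D(1) inj(1) mapp_relabel[of h "cancel E F" x]
    by (simp add: cancel_def inj_on_subset[of h "P \<union> E"] Diff_subset)
  ultimately show "exits (h ` E) (mapp (relabel h F)) p (mapp (relabel h (cancel E F)) p)"
    using x by simp
qed simp


section \<open>Composites of cobordisms\<close>

lemma apfst_image_summand: "apfst \<phi> ` summand i s X = summand (\<phi> i) s X"
  by (force simp: summand_def)

lemma apfst_image_abs_at: "apfst \<phi> ` abs_at i A = abs_at (\<phi> i) A"
  by (simp add: abs_at_def image_Un apfst_image_summand)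

lemma is_cobordismD:
  assumes "is_cobordism f A B"
  shows "source f = A" "target f = B" "signed_set A" "signed_set B"
    "is_matching (under f)
       (summand 0 Plus (pos A) \<union> summand 1 Minus (neg B))
       (summand 0 Minus (neg A) \<union> summand 1 Plus (pos B))"
  using assms by (auto simp: is_cobordism_def)

lemma inj_on_apfst: "inj_on \<phi> I \<Longrightarrow> fst ` X \<subseteq> I \<Longrightarrow> inj_on (apfst \<phi>) X"
  by (rule inj_onI, rule prod_eqI) (auto simp: apfst_def map_prod_def split_beta dest!: inj_onD)

lemma is_matching_place:
  assumes "is_cobordism f A B" "i \<noteq> j"
  shows "is_matching (place i j (under f))
    (summand i Plus (pos A) \<union> summand j Minus (neg B))
    (summand i Minus (neg A) \<union> summand j Plus (pos B))"
proof -
  let ?h = "apfst (\<lambda>k. if k = 0 then i else j) :: 'a point \<Rightarrow> 'a point"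
  have inj: "inj_on ?h X" if "fst ` X \<subseteq> {0, 1}" for X
    by (rule inj_on_apfst[OF _ that]) (use \<open>i \<noteq> j\<close> in \<open>auto simp: inj_on_def\<close>)
  have "is_matching (relabel ?h (under f))
    (?h ` (summand 0 Plus (pos A) \<union> summand 1 Minus (neg B)))
    (?h ` (summand 0 Minus (neg A) \<union> summand 1 Plus (pos B)))"
    by (rule is_matching_relabel[OF is_cobordismD(5)[OF assms(1)]]; rule inj)
      (auto simp: summand_def)
  then show ?thesis
    by (simp add: place_def image_Un apfst_image_summand)
qed

text \<open>The middle signed set occurs whole on each side: \<open>f\<close> contributes its
  negative part to the domain and its positive part to the codomain, and \<open>g\<close> the other
  two halves.\<close>

lemma place_plus_place:
  assumes f: "is_cobordism f A B" and g: "is_cobordism g B C" and d: "i \<noteq> j" "j \<noteq> k" "i \<noteq> k"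
  shows "is_matching (place i j (under f) \<oplus> place j k (under g))
    ((summand i Plus (pos A) \<union> summand k Minus (neg C)) \<union> abs_at j B)
    ((summand i Minus (neg A) \<union> summand k Plus (pos C)) \<union> abs_at j B)"
proof -
  have "is_matching (place i j (under f) \<oplus> place j k (under g))
    ((summand i Plus (pos A) \<union> summand j Minus (neg B)) \<union> (summand j Plus (pos B) \<union> summand k Minus (neg C)))
    ((summand i Minus (neg A) \<union> summand j Plus (pos B)) \<union> (summand j Minus (neg B) \<union> summand k Plus (pos C)))"
    by (rule is_matching_plus[OF is_matching_place[OF f d(1)] is_matching_place[OF g d(2)]])
      (use d in \<open>auto simp: summand_def\<close>)
  then show ?thesis
    by (simp add: abs_at_def Un_ac)
qed

lemma cancel_place_plus_place:
  assumes f: "is_cobordism f A B" and g: "is_cobordism g B C" and d: "i \<noteq> j" "j \<noteq> k" "i \<noteq> k"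
  shows "is_matching (cancel (abs_at j B) (place i j (under f) \<oplus> place j k (under g)))
    (summand i Plus (pos A) \<union> summand k Minus (neg C))
    (summand i Minus (neg A) \<union> summand k Plus (pos C))"
  by (rule is_matching_cancel[OF place_plus_place[OF assms]])
    (use d in \<open>auto simp: summand_def abs_at_def\<close>)

lemma is_cobordism_compose:
  assumes f: "is_cobordism f A B" and g: "is_cobordism g B C"
  shows "is_cobordism (f \<triangleleft> g) A C"
proof -
  let ?h = "apfst (\<lambda>k. if k = 0 then 0 else 1) :: 'a point \<Rightarrow> 'a point"
  have "is_matching (relabel ?h (cancel (abs_at 1 B) (place 0 1 (under f) \<oplus> place 1 2 (under g))))
    (?h ` (summand 0 Plus (pos A) \<union> summand 2 Minus (neg C)))
    (?h ` (summand 0 Minus (neg A) \<union> summand 2 Plus (pos C)))"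
    by (rule is_matching_relabel[OF cancel_place_plus_place[OF f g]])
      (auto simp: inj_on_def summand_def)
  then show ?thesis
    using is_cobordismD[OF f] is_cobordismD[OF g]
    by (simp add: is_cobordism_def compose_def image_Un apfst_image_summand)
qed

section \<open>Composites at arbitrary positions\<close>

lemma relabel_place:
  assumes f: "is_cobordism f A B" and "i \<noteq> j" "\<phi> i \<noteq> \<phi> j"
  shows "relabel (apfst \<phi>) (place i j (under f)) = place (\<phi> i) (\<phi> j) (under f)"
proof -
  note D = is_cobordismD(5)[OF f]
  let ?h = "apfst (\<lambda>k. if k = 0 then i else j) :: 'a point \<Rightarrow> 'a point"
  have "relabel (apfst \<phi>) (relabel ?h (under f)) = relabel (apfst \<phi> \<circ> ?h) (under f)"
  proof (rule relabel_relabel; unfold is_matchingD(1)[OF D])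
    show "inj_on ?h (summand 0 Plus (pos A) \<union> summand 1 Minus (neg B))"
      by (rule inj_on_apfst[of _ "{0, 1}"]) (use assms(2) in \<open>auto simp: summand_def\<close>)
    show "inj_on (apfst \<phi>) (?h ` (summand 0 Plus (pos A) \<union> summand 1 Minus (neg B)))"
      by (rule inj_on_apfst[of _ "{i, j}"]) (use assms(3) in \<open>auto simp: summand_def\<close>)
  qed
  also have "apfst \<phi> \<circ> ?h = apfst (\<lambda>k. if k = 0 then \<phi> i else \<phi> j)"
    by auto
  finally show ?thesis by (simp add: place_def)
qed

lemma place_compose:
  assumes f: "is_cobordism f A B" and g: "is_cobordism g B C" and d: "i \<noteq> j" "j \<noteq> k" "i \<noteq> k"
  shows "place i k (under (f \<triangleleft> g)) = cancel (abs_at j B) (place i j (under f) \<oplus> place j k (under g))"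
proof -
  let ?h = "apfst (\<lambda>k. if k = 0 then 0 else 1) :: 'a point \<Rightarrow> 'a point"
  let ?g = "apfst (\<lambda>l. if l = 0 then i else k) :: 'a point \<Rightarrow> 'a point"
  \<comment> \<open>The ends must go from \<open>0\<close> to \<open>i\<close> and from
    \<open>2\<close> to \<open>k\<close>. The value at \<open>1\<close> is free, that position being
    gone after cancelling; taking \<open>j\<close> makes the renumbering injective on all three
    positions, so that it commutes with the sum and with \<open>cancel\<close>.\<close>
  define \<phi> where "\<phi> l = (if l = 0 then i else if l = 1 then j else k)" for l :: nat
  let ?S = "place 0 1 (under f) \<oplus> place 1 2 (under g)"
  have inj: "inj_on (apfst \<phi>) X" if "fst ` X \<subseteq> {0, 1, 2}" for X :: "'a point set"
    by (rule inj_on_apfst[OF _ that]) (use d in \<open>auto simp: inj_on_def \<phi>_def\<close>)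
  have S: "is_matching ?S
    ((summand 0 Plus (pos A) \<union> summand 2 Minus (neg C)) \<union> abs_at 1 B)
    ((summand 0 Minus (neg A) \<union> summand 2 Plus (pos C)) \<union> abs_at 1 B)"
    by (rule place_plus_place[OF f g]) auto
  have cS: "is_matching (cancel (abs_at 1 B) ?S)
    (summand 0 Plus (pos A) \<union> summand 2 Minus (neg C))
    (summand 0 Minus (neg A) \<union> summand 2 Plus (pos C))"
    by (rule cancel_place_plus_place[OF f g]) auto
  have "place i k (under (f \<triangleleft> g)) = relabel ?g (relabel ?h (cancel (abs_at 1 B) ?S))"
    using is_cobordismD(2)[OF f] by (simp add: place_def compose_def)
  also have "\<dots> = relabel (?g \<circ> ?h) (cancel (abs_at 1 B) ?S)"
  proof (rule relabel_relabel; unfold is_matchingD(1)[OF cS])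
    show "inj_on ?h (summand 0 Plus (pos A) \<union> summand 2 Minus (neg C))"
      by (rule inj_on_apfst[of _ "{0, 2}"]) (auto simp: summand_def)
    show "inj_on ?g (?h ` (summand 0 Plus (pos A) \<union> summand 2 Minus (neg C)))"
      by (rule inj_on_apfst[of _ "{0, 1}"]) (use d in \<open>auto simp: summand_def\<close>)
  qed
  also have "\<dots> = relabel (apfst \<phi>) (cancel (abs_at 1 B) ?S)"
  proof (rule relabel_cong[OF cS, symmetric])
    show "inj_on (apfst \<phi>) (summand 0 Plus (pos A) \<union> summand 2 Minus (neg C))"
      by (rule inj) (auto simp: summand_def)
  qed (auto simp: summand_def \<phi>_def)
  also have "\<dots> = cancel (apfst \<phi> ` abs_at 1 B) (relabel (apfst \<phi>) ?S)"
    by (rule relabel_cancel[OF S]; rule inj) (auto simp: summand_def abs_at_def)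
  also have "relabel (apfst \<phi>) ?S =
      relabel (apfst \<phi>) (place 0 1 (under f)) \<oplus> relabel (apfst \<phi>) (place 1 2 (under g))"
  proof (intro relabel_plus inj)
    have eq: "mdom (place 0 1 (under f)) \<union> mdom (place 1 2 (under g)) = mdom ?S"
      by (simp add: matching_plus_def)
    show "fst ` (mdom (place 0 1 (under f)) \<union> mdom (place 1 2 (under g))) \<subseteq> {0, 1, 2}"
      unfolding eq is_matchingD(1)[OF S] by (auto simp: summand_def abs_at_def)
  qed
  also have "relabel (apfst \<phi>) (place 0 1 (under f)) = place i j (under f)"
    using relabel_place[OF f, of 0 1 \<phi>] d by (simp add: \<phi>_def)
  also have "relabel (apfst \<phi>) (place 1 2 (under g)) = place j k (under g)"
    using relabel_place[OF g, of 1 2 \<phi>] d by (simp add: \<phi>_def)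
  also have "apfst \<phi> ` abs_at 1 B = abs_at j B"
    by (simp add: apfst_image_abs_at \<phi>_def)
  finally show ?thesis .
qed


section \<open>Segments of a chain\<close>

text \<open>Positions stay absolute: a part of the chain keeps the tags it has in the whole sum, so
  parts can be added without renumbering.\<close>

definition segment_sum :: "(nat \<Rightarrow> 'a cobordism) \<Rightarrow> nat \<Rightarrow> nat \<Rightarrow> 'a point matching" where
  "segment_sum f a b = matching_sum (map (\<lambda>i. place (i - 1) i (under (f i))) [a + 1..<b + 1])"

definition interior :: "(nat \<Rightarrow> 'a signed) \<Rightarrow> nat \<Rightarrow> nat \<Rightarrow> 'a point set" where
  "interior A a b = (\<Union>i\<in>{a<..<b}. abs_at i (A i))"

lemma interior_iff:
  "(i, s, x) \<in> interior A a b \<longleftrightarrow> a < i \<and> i < b \<and> x \<in> (case s of Plus \<Rightarrow> pos (A i) | Minus \<Rightarrow> neg (A i))"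
  by (cases s) (auto simp: interior_def abs_at_def summand_def)

lemma abs_at_iff:
  "(i, s, x) \<in> abs_at j B \<longleftrightarrow> i = j \<and> x \<in> (case s of Plus \<Rightarrow> pos B | Minus \<Rightarrow> neg B)"
  by (cases s) (auto simp: abs_at_def summand_def)

lemma summand_iff: "(i, s, x) \<in> summand j s' X \<longleftrightarrow> i = j \<and> s = s' \<and> x \<in> X"
  by (auto simp: summand_def)

lemmas point_iffs = interior_iff abs_at_iff summand_iff

lemma interior_Suc_self: "interior A a (Suc a) = {}"
  by (auto simp: interior_def)

text \<open>The summands stand in the order in which they will be cancelled: right interior, left
  interior, junction.\<close>

lemma interior_split:
  assumes "a < c" "c < b"
  shows "interior A a b = interior A c b \<union> interior A a c \<union> abs_at c (A c)"
proof -
  have "{a<..<b} = {c<..<b} \<union> {a<..<c} \<union> {c}"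
    using assms by auto
  then show ?thesis by (simp add: interior_def UN_Un Un_ac)
qed

lemma segment_sum_append:
  assumes "a \<le> c" "c \<le> b"
  shows "segment_sum f a b = segment_sum f a c \<oplus> segment_sum f c b"
proof -
  have "[a + 1..<b + 1] = [a + 1..<c + 1] @ [c + 1..<b + 1]"
    using upt_add_eq_append[of "a + 1" "c + 1" "b - c"] assms by simp
  then show ?thesis
    by (simp only: segment_sum_def map_append matching_sum_append)
qed

lemma segment_sum_single:
  assumes "is_cobordism (f (Suc a)) A B"
  shows "segment_sum f a (Suc a) = place a (Suc a) (under (f (Suc a)))"
  using is_matchingD(5)[OF is_matching_place[OF assms, of a "Suc a"]]
  by (simp add: segment_sum_def matching_sum_single)

lemma is_matching_segment_sum:
  assumes "a < b" and "\<And>i. a < i \<Longrightarrow> i \<le> b \<Longrightarrow> is_cobordism (f i) (A (i - 1)) (A i)"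
  shows "is_matching (segment_sum f a b)
    ((summand a Plus (pos (A a)) \<union> summand b Minus (neg (A b))) \<union> interior A a b)
    ((summand a Minus (neg (A a)) \<union> summand b Plus (pos (A b))) \<union> interior A a b)"
  using assms
proof (induction b)
  case (Suc b)
  have f: "is_cobordism (f (Suc b)) (A b) (A (Suc b))"
    using Suc.prems(2)[of "Suc b"] Suc.prems(1) by simp
  note last = segment_sum_single[of f b, OF f]
  have M: "is_matching (segment_sum f b (Suc b))
    (summand b Plus (pos (A b)) \<union> summand (Suc b) Minus (neg (A (Suc b))))
    (summand b Minus (neg (A b)) \<union> summand (Suc b) Plus (pos (A (Suc b))))"
    unfolding last by (rule is_matching_place[OF f]) simp
  show ?case
  proof (cases "a = b")
    case True
    then show ?thesis using M by (simp add: interior_Suc_self)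
  next
    case False
    then have "a < b" using Suc.prems by simp
    then have IH: "is_matching (segment_sum f a b)
      ((summand a Plus (pos (A a)) \<union> summand b Minus (neg (A b))) \<union> interior A a b)
      ((summand a Minus (neg (A a)) \<union> summand b Plus (pos (A b))) \<union> interior A a b)"
      using Suc by simp
    have int: "interior A a (Suc b) = interior A a b \<union> abs_at b (A b)"
      using interior_split[of a b "Suc b" A] \<open>a < b\<close> by (simp add: interior_Suc_self)
    have "segment_sum f a (Suc b) = segment_sum f a b \<oplus> segment_sum f b (Suc b)"
      using \<open>a < b\<close> by (intro segment_sum_append) auto
    \<comment> \<open>At the shared position \<open>b\<close> the two terms are kept apart by sign,
      elsewhere by position.\<close>
    moreover have "is_matching (segment_sum f a b \<oplus> segment_sum f b (Suc b))
      (((summand a Plus (pos (A a)) \<union> summand b Minus (neg (A b))) \<union> interior A a b) \<union>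
        (summand b Plus (pos (A b)) \<union> summand (Suc b) Minus (neg (A (Suc b)))))
      (((summand a Minus (neg (A a)) \<union> summand b Plus (pos (A b))) \<union> interior A a b) \<union>
        (summand b Minus (neg (A b)) \<union> summand (Suc b) Plus (pos (A (Suc b)))))"
      by (rule is_matching_plus[OF IH M]) (use \<open>a < b\<close> in \<open>auto simp: point_iffs\<close>)
    ultimately show ?thesis
      by (simp add: int abs_at_def Un_ac)
  qed
qed simp

lemma is_matching_cancel_segment_sum:
  assumes "a < b" and "\<And>i. a < i \<Longrightarrow> i \<le> b \<Longrightarrow> is_cobordism (f i) (A (i - 1)) (A i)"
  shows "is_matching (cancel (interior A a b) (segment_sum f a b))
    (summand a Plus (pos (A a)) \<union> summand b Minus (neg (A b)))
    (summand a Minus (neg (A a)) \<union> summand b Plus (pos (A b)))"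
  by (rule is_matching_cancel[OF is_matching_segment_sum[of a b f A]])
    (use assms in \<open>auto simp: point_iffs\<close>)

text \<open>This is one node of a bracketing. The set at \<open>c\<close> is an end of both halves
  and can be cancelled only in their sum, whereas each interior lies in one half and can be moved
  out of the sum.\<close>

lemma cancel_segment_sum_split:
  assumes ab: "a < c" "c < b"
    and cob: "\<And>i. a < i \<Longrightarrow> i \<le> b \<Longrightarrow> is_cobordism (f i) (A (i - 1)) (A i)"
  shows "cancel (abs_at c (A c))
      (cancel (interior A a c) (segment_sum f a c) \<oplus> cancel (interior A c b) (segment_sum f c b)) =
    cancel (interior A a b) (segment_sum f a b)"
proof -
  let ?S1 = "segment_sum f a c" and ?S2 = "segment_sum f c b"
  let ?E1 = "interior A a c" and ?E2 = "interior A c b" and ?Ec = "abs_at c (A c)"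
  let ?P = "summand a Plus (pos (A a)) \<union> summand b Minus (neg (A b))"
  let ?Q = "summand a Minus (neg (A a)) \<union> summand b Plus (pos (A b))"
  have S1: "is_matching ?S1
    ((summand a Plus (pos (A a)) \<union> summand c Minus (neg (A c))) \<union> ?E1)
    ((summand a Minus (neg (A a)) \<union> summand c Plus (pos (A c))) \<union> ?E1)"
    by (rule is_matching_segment_sum) (use ab cob in auto)
  have S2: "is_matching ?S2
    ((summand c Plus (pos (A c)) \<union> summand b Minus (neg (A b))) \<union> ?E2)
    ((summand c Minus (neg (A c)) \<union> summand b Plus (pos (A b))) \<union> ?E2)"
    by (rule is_matching_segment_sum) (use ab cob in auto)
  have cS2: "is_matching (cancel ?E2 ?S2)
    (summand c Plus (pos (A c)) \<union> summand b Minus (neg (A b)))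
    (summand c Minus (neg (A c)) \<union> summand b Plus (pos (A b)))"
    by (rule is_matching_cancel_segment_sum) (use ab cob in auto)
  have "is_matching (segment_sum f a b) (?P \<union> interior A a b) (?Q \<union> interior A a b)"
    by (rule is_matching_segment_sum) (use ab cob in auto)
  then have S: "is_matching (?S1 \<oplus> ?S2) (?P \<union> (?E2 \<union> ?E1 \<union> ?Ec)) (?Q \<union> (?E2 \<union> ?E1 \<union> ?Ec))"
    using segment_sum_append[of a c b f] interior_split[of a c b A] ab by simp
  have "cancel ?E1 ?S1 \<oplus> cancel ?E2 ?S2 = cancel ?E1 (?S1 \<oplus> cancel ?E2 ?S2)"
    by (rule cancel_plus_left[OF S1 cS2, symmetric]) (use ab in \<open>auto simp: point_iffs\<close>)
  also have "?S1 \<oplus> cancel ?E2 ?S2 = cancel ?E2 (?S1 \<oplus> ?S2)"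
    by (rule cancel_plus_right[OF S1 S2, symmetric]) (use ab in \<open>auto simp: point_iffs\<close>)
  \<comment> \<open>The junction is still an outer set here; it becomes the cancelled one in the
    next step.\<close>
  also have "cancel ?E1 (cancel ?E2 (?S1 \<oplus> ?S2)) = cancel (?E2 \<union> ?E1) (?S1 \<oplus> ?S2)"
    by (rule cancel_cancel[where P = "?P \<union> ?Ec" and Q = "?Q \<union> ?Ec"])
      (use S ab in \<open>auto simp: point_iffs Un_ac\<close>)
  also have "cancel ?Ec (cancel (?E2 \<union> ?E1) (?S1 \<oplus> ?S2)) = cancel (?E2 \<union> ?E1 \<union> ?Ec) (?S1 \<oplus> ?S2)"
    by (rule cancel_cancel[where P = ?P and Q = ?Q])
      (use S ab in \<open>auto simp: point_iffs Un_ac\<close>)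
  finally show ?thesis
    using segment_sum_append[of a c b f] interior_split[of a c b A] ab by simp
qed

section \<open>Induction over bracketings\<close>

lemma leaves_nonempty: "leaves t \<noteq> []"
  by (induction t) auto

text \<open>Both ends vary, because the two subtrees of a node cover segments starting at different
  positions. Being a cobordism is proved along with the formula, as \<open>place_compose\<close>
  asks it of both subtrees.\<close>

lemma composite_segment:
  assumes "leaves t = map f [a + 1..<b + 1]"
    and "\<And>i. a < i \<Longrightarrow> i \<le> b \<Longrightarrow> is_cobordism (f i) (A (i - 1)) (A i)"
  shows "is_cobordism (composite t) (A a) (A b) \<and>
    place a b (under (composite t)) = cancel (interior A a b) (segment_sum f a b)"
  using assms
proof (induction t arbitrary: a b)
  case (Leaf g)
  have b: "b = Suc a"
    using arg_cong[OF Leaf.prems(1), of length] by (simp del: upt_Suc)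
  then have g: "g = f (Suc a)" using Leaf.prems(1) by simp
  have cob: "is_cobordism (f (Suc a)) (A a) (A (Suc a))"
    using Leaf.prems(2)[of "Suc a"] b by simp
  \<comment> \<open>A single cobordism has an empty interior, and cancelling nothing lets every
    point exit at its first step.\<close>
  have "cancel {} (segment_sum f a b) = segment_sum f a b"
    by (rule cancel_eqI) (use extensional_matching_sum in \<open>auto simp: segment_sum_def intro: exits_base\<close>)
  then show ?case
    using cob g b interior_Suc_self[of A a] segment_sum_single[of f a, OF cob] by simp
next
  case (Node l r)
  \<comment> \<open>The junction of the two subtrees; each has at least one leaf, so it lies
    strictly between \<open>a\<close> and \<open>b\<close>.\<close>
  define c where "c = a + length (leaves l)"
  have len: "length (leaves l) + length (leaves r) = b - a"
    using arg_cong[OF Node.prems(1), of length] by (simp del: upt_Suc)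
  then have ab: "a < c" "c < b"
    using leaves_nonempty[of l] leaves_nonempty[of r] by (auto simp: c_def neq_Nil_conv)
  have "[a + 1..<b + 1] = [a + 1..<c + 1] @ [c + 1..<b + 1]"
    using upt_add_eq_append[of "a + 1" "c + 1" "b - c"] ab by simp
  then have "leaves l @ leaves r = map f [a + 1..<c + 1] @ map f [c + 1..<b + 1]"
    using Node.prems(1) by (simp only: leaves.simps map_append)
  \<comment> \<open>By the choice of \<open>c\<close>, the first parts of the two concatenations
    have equal length.\<close>
  then have lr: "leaves l = map f [a + 1..<c + 1]" "leaves r = map f [c + 1..<b + 1]"
    by (simp_all add: append_eq_append_conv c_def del: upt_Suc)
  have L: "is_cobordism (composite l) (A a) (A c)"
    "place a c (under (composite l)) = cancel (interior A a c) (segment_sum f a c)"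
    using Node.IH(1)[OF lr(1)] Node.prems(2) ab by auto
  have R: "is_cobordism (composite r) (A c) (A b)"
    "place c b (under (composite r)) = cancel (interior A c b) (segment_sum f c b)"
    using Node.IH(2)[OF lr(2)] Node.prems(2) ab by auto
  have "place a b (under (composite l \<triangleleft> composite r)) =
      cancel (abs_at c (A c)) (place a c (under (composite l)) \<oplus> place c b (under (composite r)))"
    by (rule place_compose[OF L(1) R(1)]) (use ab in auto)
  also have "\<dots> = cancel (interior A a b) (segment_sum f a b)"
    unfolding L(2) R(2) by (rule cancel_segment_sum_split) (use ab Node.prems(2) in auto)
  finally show ?case
    using is_cobordism_compose[OF L(1) R(1)] by simp
qed

theorem corollary4:
  fixes n :: nat
    and A :: "nat \<Rightarrow> 'a signed"
    and f :: "nat \<Rightarrow> 'a cobordism"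
  assumes "n \<ge> 1"
    and "\<And>i. i \<le> n \<Longrightarrow> signed_set (A i)"
    and "\<And>i. 1 \<le> i \<Longrightarrow> i \<le> n \<Longrightarrow> is_cobordism (f i) (A (i - 1)) (A i)"
  shows "(\<forall>t. leaves t = map f [1..<n + 1] \<longrightarrow>
            is_cobordism (composite t) (A 0) (A n) \<and>
            place 0 n (under (composite t)) =
              cancel (\<Union>i\<in>{1..<n}. abs_at i (A i)) (chain_sum n f)) \<and>
         (unsigned (A 0) \<and> unsigned (A n) \<longrightarrow>
            is_matching
              (relabel untag (cancel (\<Union>i\<in>{1..<n}. abs_at i (A i)) (chain_sum n f)))
              (pos (A 0)) (pos (A n)))"
proof -
  have "{1..<n} = {0<..<n}" by auto
  then have int: "(\<Union>i\<in>{1..<n}. abs_at i (A i)) = interior A 0 n"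
    by (simp add: interior_def)
  have sum: "chain_sum n f = segment_sum f 0 n"
    by (simp add: chain_sum_def segment_sum_def)
  have cob: "is_cobordism (f i) (A (i - 1)) (A i)" if "0 < i" "i \<le> n" for i
    using assms(3) that by simp
  let ?M = "cancel (interior A 0 n) (segment_sum f 0 n)"
  \<comment> \<open>Read off the cancelled sum itself, not from a composite. With unsigned ends the
    \<open>Minus\<close> summands at \<open>0\<close> and \<open>n\<close> are empty.\<close>
  have "is_matching (relabel untag ?M) (pos (A 0)) (pos (A n))"
    if "unsigned (A 0)" "unsigned (A n)"
  proof -
    have "is_matching ?M (summand 0 Plus (pos (A 0))) (summand n Plus (pos (A n)))"
      using is_matching_cancel_segment_sum[of 0 n f A] cob assms(1) that
      by (simp add: unsigned_def summand_def)
    \<comment> \<open>Domain and codomain each occupy one position and one sign, so forgetting the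
      tags is injective on each.\<close>
    then have "is_matching (relabel untag ?M)
        (untag ` summand 0 Plus (pos (A 0))) (untag ` summand n Plus (pos (A n)))"
      by (rule is_matching_relabel) (auto simp: inj_on_def untag_def summand_def)
    moreover have "untag ` summand i s X = X" for i s and X :: "'a set"
      by (force simp: untag_def summand_def)
    ultimately show ?thesis by simp
  qed
  then show ?thesis
    using composite_segment[of _ f 0 n A] cob unfolding int sum by simp
qed

end
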